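(* Let $A,B,F,G$ be finite nonempty subsets of a commutative group, written multiplicatively. Then $$\left|\frac{F^{(2)}G^{(2)}}{F^{(2)}G}\right|\ \le\ |AB|\left(\frac{|AF|}{|A|}\right)^4\left(\frac{|BG|}{|B|}\right)^3 .$$ In particular, if $t,m>0$ are such that $|AF|,|BG|,|AB|\le t$ and $|A|,|B|\ge m$, then $$\left|\frac{F^{(2)}G^{(2)}}{F^{(2)}G}\right|\ \le\ \frac{t^8}{|A|^4|B|^3}\ \le\ \frac{t^8}{m^7}.$$
   Context: Product sets: $UV=\{uv:u\in U,v\in V\}$; quotient sets: $U/V=\{uv^{-1}:u\in U,v\in V\}$; $F^{(j)}=\{f_1\cdots f_j:f_i\in F\}$ is the $j$-fold product set with independent choices of the factors. *)

theory Defs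
  imports "HOL-Algebra.Algebra"
begin

text \<open>Product sets \<open>U V\<close> are the library's \<^const>\<open>set_mult\<close>, written \<open>U <#>\<^bsub>G\<^esub> V\<close>.\<close>

definition quotient_set :: "('a, 'b) monoid_scheme \<Rightarrow> 'a set \<Rightarrow> 'a set \<Rightarrow> 'a set"
    (infixl \<open><'/>\<index>\<close> 60)
  where "U </>\<^bsub>G\<^esub> V = {u \<otimes>\<^bsub>G\<^esub> inv\<^bsub>G\<^esub> v | u v. u \<in> U \<and> v \<in> V}"

text \<open>The factors are indexed by \<open>{..<j}\<close>. The definition is meant for subsets of the carrier of a
  commutative group, as \<^const>\<open>finprod\<close> needs commutativity.\<close>

definition fold_product_set :: "('a, 'b) monoid_scheme \<Rightarrow> nat \<Rightarrow> 'a set \<Rightarrow> 'a set"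
  where "fold_product_set G j F = {finprod G f {..<j} | f. \<forall>i<j. f i \<in> F}"

end

theory Submission
  imports Defs
begin

text \<open>By Petridis' lemma there are nonempty \<open>S \<subseteq> A\<close> and \<open>T \<subseteq> B\<close> such that multiplying any
  set \<open>C S\<close> by \<open>F\<close> (any set \<open>C T\<close> by \<open>G\<close>) increases its size by a factor of at most
  \<open>\<alpha> = |A F| / |A|\<close> (at most \<open>\<beta> = |B G| / |B|\<close>). Hence multiplying \<open>S T\<close> by \<open>F F G G\<close> and by \<open>F F G\<close> costs
  factors \<open>\<alpha>\<^sup>2 \<beta>\<^sup>2\<close> and \<open>\<alpha>\<^sup>2 \<beta>\<close>, and Ruzsa's triangle inequality \<open>|U / V| |W| \<le> |U W| |V W|\<close> with
  \<open>W = S T\<close> gives the bound \<open>\<alpha>\<^sup>4 \<beta>\<^sup>3 |S T|\<close>.\<close>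

lemma finite_set_mult:
  assumes "finite H" "finite K"
  shows "finite (H <#>\<^bsub>G\<^esub> K)"
  unfolding set_mult_def using assms by auto

lemma set_mult_nonempty:
  assumes "H \<noteq> {}" "K \<noteq> {}"
  shows "H <#>\<^bsub>G\<^esub> K \<noteq> {}"
  unfolding set_mult_def using assms by auto

lemma finite_quotient_set:
  assumes "finite U" "finite V"
  shows "finite (U </>\<^bsub>G\<^esub> V)"
proof -
  have "U </>\<^bsub>G\<^esub> V = (\<lambda>(u, v). u \<otimes>\<^bsub>G\<^esub> inv\<^bsub>G\<^esub> v) ` (U \<times> V)"
    unfolding quotient_set_def by auto
  then show ?thesis
    using assms by simp
qed

lemma quotient_set_mono:
  assumes "U \<subseteq> U'" "V \<subseteq> V'"
  shows "U </>\<^bsub>G\<^esub> V \<subseteq> U' </>\<^bsub>G\<^esub> V'"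
  unfolding quotient_set_def using assms by auto

lemma set_mult_insert_left:
  "insert c C <#>\<^bsub>G\<^esub> H = (C <#>\<^bsub>G\<^esub> H) \<union> (c <#\<^bsub>G\<^esub> H)"
  unfolding set_mult_def l_coset_def by auto

lemma (in group) card_l_coset:
  assumes "c \<in> carrier G" "H \<subseteq> carrier G"
  shows "card (c <# H) = card H"
proof -
  have "c <# H = (\<lambda>h. c \<otimes> h) ` H"
    unfolding l_coset_def by auto
  moreover have "inj_on (\<lambda>h. c \<otimes> h) H"
    using assms by (meson inj_on_def l_cancel subsetD)
  ultimately show ?thesis
    by (simp add: card_image)
qed

text \<open>Fix one representation \<open>d = p d \<otimes> inv q d\<close> of each quotient
  \<open>d\<close>. Then \<open>(d, w)\<close> goes to
  \<open>(p d \<otimes> w, q d \<otimes> w)\<close>, an injection of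
  \<open>(U </> V) \<times> W\<close> into \<open>(U <#> W) \<times> (V <#> W)\<close>.\<close>

lemma (in group) ruzsa_triangle:
  assumes "U \<subseteq> carrier G" "V \<subseteq> carrier G" "W \<subseteq> carrier G"
    and "finite U" "finite V" "finite W"
  shows "card (U </> V) * card W \<le> card (U <#> W) * card (V <#> W)"
proof -
  have "\<forall>d\<in>U </> V. \<exists>u v. u \<in> U \<and> v \<in> V \<and> d = u \<otimes> inv v"
    unfolding quotient_set_def by auto
  then obtain p q where pq: "\<And>d. d \<in> U </> V \<Longrightarrow> p d \<in> U \<and> q d \<in> V \<and> d = p d \<otimes> inv q d"
    by metis
  let ?\<phi> = "\<lambda>(d, w). (p d \<otimes> w, q d \<otimes> w)"
  \<comment> \<open>The quotient of the two image coordinates cancels \<open>w\<close>, so the image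
    alone determines \<open>d\<close>.\<close>
  have recover: "d = (p d \<otimes> w) \<otimes> inv (q d \<otimes> w)" if "d \<in> U </> V" "w \<in> W" for d w
  proof -
    have "p d \<in> carrier G" "q d \<in> carrier G" "w \<in> carrier G"
      using pq[OF that(1)] that(2) assms(1-3) by auto
    then have "(p d \<otimes> w) \<otimes> inv (q d \<otimes> w) = p d \<otimes> inv q d"
      by (metis inv_closed inv_mult_group inv_solve_right m_assoc m_closed)
    then show ?thesis
      using pq[OF that(1)] by simp
  qed
  have "inj_on ?\<phi> ((U </> V) \<times> W)"
  proof (rule inj_onI, clarify)
    fix d w d' w'
    assume in1: "d \<in> U </> V" "w \<in> W" and in2: "d' \<in> U </> V" "w' \<in> W"
      and eq: "p d \<otimes> w = p d' \<otimes> w'" "q d \<otimes> w = q d' \<otimes> w'"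
    have "d = d'"
      using recover[OF in1] recover[OF in2] eq by simp
    \<comment> \<open>Equal quotients share the chosen numerator \<open>p d\<close>, which cancels
      from the first coordinates.\<close>
    moreover have "w = w'"
      using eq(1) pq[OF in1(1)] in1 in2 assms(1,3) \<open>d = d'\<close> by (meson l_cancel subsetD)
    ultimately show "d = d' \<and> w = w'" ..
  qed
  moreover have "?\<phi> ` ((U </> V) \<times> W) \<subseteq> (U <#> W) \<times> (V <#> W)"
    using pq by (auto simp: set_mult_def)
  moreover have "finite ((U <#> W) \<times> (V <#> W))"
    using assms by (simp add: finite_set_mult)
  ultimately have "card ((U </> V) \<times> W) \<le> card ((U <#> W) \<times> (V <#> W))"
    by (rule card_inj_on_le)
  then show ?thesis
    by (simp add: card_cartesian_product)
qed

text \<open>Adding \<open>c\<close> to \<open>C\<close> contributes to \<open>C <#> S\<close> only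
  the part of \<open>c <# S\<close> not yet covered. The overlap, multiplied by \<open>F\<close>, is
  already covered in \<open>C <#> S <#> F\<close>, and by \<open>min\<close> this saves at least
  \<open>k\<close> times the size of the overlap, so the factor \<open>k\<close> survives the
  induction.\<close>

lemma (in group) petridis:
  fixes k :: real
  assumes "S \<subseteq> carrier G" "F \<subseteq> carrier G" "finite S" "finite F"
    and le: "card (S <#> F) \<le> k * card S"
    and min: "\<And>Z. Z \<subseteq> S \<Longrightarrow> k * card Z \<le> card (Z <#> F)"
    and "finite C" "C \<subseteq> carrier G"
  shows "card (C <#> S <#> F) \<le> k * card (C <#> S)"
  using assms(7,8)
proof (induction C rule: finite_induct)
  case empty
  then show ?case
    by (simp add: set_mult_def)
next
  case (insert c C)
  then have c: "c \<in> carrier G" and C: "C \<subseteq> carrier G" "finite C"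
    by auto
  note closed = set_mult_closed finite_set_mult assms(1-4) C
  \<comment> \<open>\<open>c <# Z\<close> is exactly the part of \<open>c <# S\<close> inside
    \<open>C <#> S\<close>; the rest is new.\<close>
  define Z where "Z = {x \<in> S. c \<otimes> x \<in> C <#> S}"
  have Z: "Z \<subseteq> S" "Z \<subseteq> carrier G" "finite Z"
    using assms(1,3) by (auto simp: Z_def)
  have "insert c C <#> S = (C <#> S) \<union> ((c <# S) - (c <# Z))"
    unfolding set_mult_insert_left by (auto simp: Z_def l_coset_def)
  moreover have "(C <#> S) \<inter> ((c <# S) - (c <# Z)) = {}"
    by (auto simp: Z_def l_coset_def)
  moreover have "c <# Z \<subseteq> c <# S" "finite (c <# S)"
    using Z assms(3) by (auto simp: l_coset_def)
  ultimately have "card (insert c C <#> S) = card (C <#> S) + (card (c <# S) - card (c <# Z))"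
    by (simp add: closed card_Un_disjoint card_Diff_subset finite_subset)
  \<comment> \<open>Subtraction of naturals truncates; this bound makes it agree with subtraction of
    reals.\<close>
  moreover have "card Z \<le> card S"
    using Z assms(3) by (simp add: card_mono)
  ultimately have lower: "real (card (insert c C <#> S)) = card (C <#> S) + (real (card S) - card Z)"
    using c Z assms(1) by (simp add: card_l_coset)
  have assoc: "(c <# S) <#> F = c <# (S <#> F)" "(c <# Z) <#> F = c <# (Z <#> F)"
    using c Z assms(1,2) by (simp_all add: l_coset_eq_set_mult set_mult_assoc)
  have "c <# Z \<subseteq> C <#> S"
    by (auto simp: Z_def l_coset_def)
  then have "c <# (Z <#> F) \<subseteq> C <#> S <#> F"
    unfolding assoc(2)[symmetric] by (rule mono_set_mult) simp
  moreover have "insert c C <#> S <#> F = (C <#> S <#> F) \<union> (c <# (S <#> F))"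
    unfolding set_mult_insert_left assoc(1)[symmetric] by (auto simp: set_mult_def)
  ultimately have "insert c C <#> S <#> F = (C <#> S <#> F) \<union> ((c <# (S <#> F)) - (c <# (Z <#> F)))"
    by auto
  then have "card (insert c C <#> S <#> F)
      \<le> card (C <#> S <#> F) + card ((c <# (S <#> F)) - (c <# (Z <#> F)))"
    by (simp add: card_Un_le)
  also have "card ((c <# (S <#> F)) - (c <# (Z <#> F))) = card (c <# (S <#> F)) - card (c <# (Z <#> F))"
  proof (rule card_Diff_subset)
    show "finite (c <# (Z <#> F))"
      using Z(3) assms(4) by (simp add: finite_set_mult l_coset_def)
    show "c <# (Z <#> F) \<subseteq> c <# (S <#> F)"
      using Z(1) by (auto simp: l_coset_def set_mult_def)
  qed
  also have "\<dots> = card (S <#> F) - card (Z <#> F)"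
    using c Z assms(1,2) by (simp add: card_l_coset set_mult_closed)
  finally have "card (insert c C <#> S <#> F) \<le> card (C <#> S <#> F) + (card (S <#> F) - card (Z <#> F))" .
  moreover have "card (Z <#> F) \<le> card (S <#> F)"
    using Z assms(3,4) by (intro card_mono mono_set_mult finite_set_mult) auto
  ultimately have "real (card (insert c C <#> S <#> F))
      \<le> card (C <#> S <#> F) + (real (card (S <#> F)) - card (Z <#> F))"
    by linarith
  \<comment> \<open>The induction hypothesis bounds the first term, \<open>le\<close> the second,
    and \<open>min\<close> bounds the subtracted one from below.\<close>
  also have "\<dots> \<le> k * card (C <#> S) + (k * card S - k * card Z)"
    using insert.IH[OF C(1)] le min[OF Z(1)] by linarith
  also have "\<dots> = k * card (insert c C <#> S)"
    unfolding lower by (simp add: algebra_simps)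
  finally show ?case .
qed

text \<open>Among the nonempty subsets of \<open>A\<close>, let \<open>S\<close> minimise
  \<open>card (S <#> F) / card S\<close>. Minimality is what \<open>petridis\<close> asks for with
  this ratio as \<open>k\<close>, and \<open>A\<close> is itself a competitor, so the ratio is at
  most that of \<open>A\<close>.\<close>

lemma (in group) petridis_subset:
  assumes "A \<subseteq> carrier G" "F \<subseteq> carrier G" "finite A" "finite F" "A \<noteq> {}"
  obtains S where "S \<subseteq> A" "S \<noteq> {}"
    "\<And>C. finite C \<Longrightarrow> C \<subseteq> carrier G \<Longrightarrow>
      card (C <#> S <#> F) \<le> (card (A <#> F) / card A) * card (C <#> S)"
proof -
  let ?r = "\<lambda>S. real (card (S <#> F)) / card S"
  let ?P = "Pow A - {{}}"
  have "finite ?P" "?P \<noteq> {}"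
    using assms(3,5) by auto
  from ex_min_if_finite[of "?r ` ?P"] this
  obtain S where S: "S \<subseteq> A" "S \<noteq> {}" and min: "\<And>Z. Z \<subseteq> A \<Longrightarrow> Z \<noteq> {} \<Longrightarrow> ?r S \<le> ?r Z"
    by (auto simp: not_less)
  have fin: "finite S"
    using S(1) assms(3) finite_subset by blast
  have "card (C <#> S <#> F) \<le> ?r A * card (C <#> S)" if C: "finite C" "C \<subseteq> carrier G" for C
  proof -
    have "card (C <#> S <#> F) \<le> ?r S * card (C <#> S)"
    proof (rule petridis[OF _ assms(2) fin assms(4) _ _ C])
      show "S \<subseteq> carrier G"
        using S(1) assms(1) by blast
      show "card (S <#> F) \<le> ?r S * card S"
        using S(2) fin by simp
      show "?r S * card Z \<le> card (Z <#> F)" if "Z \<subseteq> S" for Z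
      \<comment> \<open>Minimality only speaks of nonempty sets; for empty \<open>Z\<close> both
        sides are 0.\<close>
      proof (cases "Z = {}")
        case False
        then have "?r S \<le> ?r Z" "card Z > 0"
          using min that S(1) fin by (auto simp: card_gt_0_iff finite_subset)
        then show ?thesis
          by (simp add: pos_le_divide_eq)
      qed simp
    qed
    also have "\<dots> \<le> ?r A * card (C <#> S)"
      using min[of A] assms(5) by (intro mult_right_mono) auto
    finally show ?thesis .
  qed
  then show thesis
    using that S by blast
qed

lemma (in comm_group) set_mult_comm:
  assumes "H \<subseteq> carrier G" "K \<subseteq> carrier G"
  shows "H <#> K = K <#> H"
proof -
  have "h \<otimes> k = k \<otimes> h" if "h \<in> H" "k \<in> K" for h k
    using that assms m_comm by blast
  then show ?thesis
    unfolding set_mult_def by fastforce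
qed

text \<open>This inclusion is enough for an upper bound, because quotient sets grow with their
  arguments.\<close>

lemma (in comm_group) fold_product_set_two_subset:
  assumes "F \<subseteq> carrier G"
  shows "fold_product_set G 2 F \<subseteq> F <#> F"
proof
  fix x
  assume "x \<in> fold_product_set G 2 F"
  then obtain f :: "nat \<Rightarrow> 'a" where "\<forall>i<2. f i \<in> F" and x: "x = finprod G f {..<2}"
    unfolding fold_product_set_def by blast
  then have f: "f 0 \<in> F" "f 1 \<in> F"
    by auto
  have "{..<2::nat} = {0, 1}"
    by auto
  then have "x = f 0 \<otimes> f 1"
    using f assms unfolding x by (subst \<open>{..<2} = _\<close>, subst finprod_insert) (auto simp: subset_iff)
  then show "x \<in> F <#> F"
    using f unfolding set_mult_def by auto
qed

text \<open>\<open>H\<close> is the set called \<open>G\<close> in the theorem, since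
  \<open>G\<close> names the group here. Numerator and denominator grow \<open>S <#> T\<close> by
  \<alpha> twice each and by \<beta> twice and once; their product gives the exponents 4 and
  3.\<close>

lemma (in comm_group) card_quotient_set_le:
  assumes carr: "A \<subseteq> carrier G" "B \<subseteq> carrier G" "F \<subseteq> carrier G" "H \<subseteq> carrier G"
    and fin: "finite A" "finite B" "finite F" "finite H"
    and ne: "A \<noteq> {}" "B \<noteq> {}"
  shows "card ((F <#> F <#> (H <#> H)) </> (F <#> F <#> H))
    \<le> card (A <#> B) * (card (A <#> F) / card A) ^ 4 * (card (B <#> H) / card B) ^ 3"
proof -
  define \<alpha> \<beta> where "\<alpha> = real (card (A <#> F)) / card A" and "\<beta> = real (card (B <#> H)) / card B"
  have nonneg: "\<alpha> \<ge> 0" "\<beta> \<ge> 0"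
    by (simp_all add: \<alpha>_def \<beta>_def)
  obtain S where S: "S \<subseteq> A" "S \<noteq> {}"
    and growS: "\<And>C. finite C \<Longrightarrow> C \<subseteq> carrier G \<Longrightarrow> card (C <#> S <#> F) \<le> \<alpha> * card (C <#> S)"
    using petridis_subset[OF carr(1,3) fin(1,3) ne(1)] unfolding \<alpha>_def by blast
  obtain T where T: "T \<subseteq> B" "T \<noteq> {}"
    and growT: "\<And>C. finite C \<Longrightarrow> C \<subseteq> carrier G \<Longrightarrow> card (C <#> T <#> H) \<le> \<beta> * card (C <#> T)"
    using petridis_subset[OF carr(2,4) fin(2,4) ne(2)] unfolding \<beta>_def by blast
  have ST: "S \<subseteq> carrier G" "T \<subseteq> carrier G" "finite S" "finite T"
    using S(1) T(1) carr(1,2) fin(1,2) by (auto intro: finite_subset)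
  note facts = carr(3,4) fin(3,4) ST set_mult_closed finite_set_mult
  have swap: "P <#> Q <#> R = P <#> R <#> Q"
    if "P \<subseteq> carrier G" "Q \<subseteq> carrier G" "R \<subseteq> carrier G" for P Q R
    using that set_mult_assoc set_mult_comm[OF that(2,3)] by metis
  have growS': "card (S <#> C <#> F) \<le> \<alpha> * card (S <#> C)"
    if "finite C" "C \<subseteq> carrier G" for C
    using growS[OF that] set_mult_comm[OF ST(1) that(2)] by simp
  let ?W = "S <#> T"
  have F1: "card (?W <#> F) \<le> \<alpha> * card ?W"
    using growS'[of T] by (simp add: facts)
  \<comment> \<open>The first \<open>F\<close> is absorbed into the free set
    \<open>C = T <#> F\<close>, so the second one costs only another \<alpha>.\<close>
  have "card (?W <#> F <#> F) \<le> \<alpha> * card (?W <#> F)"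
    using growS'[of "T <#> F"] by (simp add: facts set_mult_assoc)
  also have "\<dots> \<le> \<alpha> * (\<alpha> * card ?W)"
    using F1 nonneg by (intro mult_left_mono)
  finally have F2: "card (?W <#> F <#> F) \<le> \<alpha> * (\<alpha> * card ?W)" .
  \<comment> \<open>The free set of \<open>growT\<close> is taken to be \<open>S <#> C\<close>;
    \<open>swap\<close> then brings \<open>T\<close> back next to \<open>S\<close>.\<close>
  have grow: "card (?W <#> C <#> H) \<le> \<beta> * card (?W <#> C)"
    if "finite C" "C \<subseteq> carrier G" for C
    using growT[of "S <#> C"] swap[of S C T] that by (simp add: facts)
  have "card (?W <#> (F <#> F) <#> H) \<le> \<beta> * card (?W <#> (F <#> F))"
    using grow by (simp add: facts)
  also have "\<dots> \<le> \<beta> * (\<alpha> * (\<alpha> * card ?W))"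
    using F2 nonneg by (intro mult_left_mono) (simp_all add: facts set_mult_assoc)
  finally have G1: "card (?W <#> (F <#> F) <#> H) \<le> \<beta> * (\<alpha> * (\<alpha> * card ?W))" .
  \<comment> \<open>Now the first \<open>H\<close> is absorbed into the free set as well.\<close>
  have "card (?W <#> (F <#> F <#> H) <#> H) \<le> \<beta> * card (?W <#> (F <#> F <#> H))"
    using grow by (simp add: facts)
  also have "\<dots> \<le> \<beta> * (\<beta> * (\<alpha> * (\<alpha> * card ?W)))"
    using G1 nonneg by (intro mult_left_mono) (simp_all add: facts set_mult_assoc)
  finally have G2: "card (?W <#> (F <#> F <#> H) <#> H) \<le> \<beta> * (\<beta> * (\<alpha> * (\<alpha> * card ?W)))" .
  let ?U = "F <#> F <#> (H <#> H)" and ?V = "F <#> F <#> H"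
  have "?U <#> ?W = ?W <#> (F <#> F <#> H) <#> H"
    using set_mult_comm[of ?U ?W] by (simp add: facts set_mult_assoc)
  then have U: "card (?U <#> ?W) \<le> \<alpha> ^ 2 * \<beta> ^ 2 * card ?W"
    using G2 by (simp add: power2_eq_square ac_simps)
  have "?V <#> ?W = ?W <#> (F <#> F) <#> H"
    using set_mult_comm[of ?V ?W] by (simp add: facts set_mult_assoc)
  then have V: "card (?V <#> ?W) \<le> \<alpha> ^ 2 * \<beta> * card ?W"
    using G1 by (simp add: power2_eq_square ac_simps)
  \<comment> \<open>Needed to cancel one of the two factors \<open>card ?W\<close> that the triangle
    inequality leaves on the right.\<close>
  have W: "card ?W > 0"
    using S(2) T(2) by (simp add: facts card_gt_0_iff set_mult_nonempty)
  have "real (card (?U </> ?V)) * card ?W = real (card (?U </> ?V) * card ?W)"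
    by simp
  also have "\<dots> \<le> real (card (?U <#> ?W) * card (?V <#> ?W))"
    using ruzsa_triangle[of ?U ?V ?W] by (intro of_nat_mono) (simp add: facts)
  also have "\<dots> \<le> (\<alpha> ^ 2 * \<beta> ^ 2 * card ?W) * (\<alpha> ^ 2 * \<beta> * card ?W)"
    unfolding of_nat_mult using U V nonneg by (intro mult_mono) auto
  also have "\<dots> = (card ?W * \<alpha> ^ 4 * \<beta> ^ 3) * card ?W"
    by (simp add: power_numeral_reduce ac_simps)
  finally have "real (card (?U </> ?V)) \<le> card ?W * \<alpha> ^ 4 * \<beta> ^ 3"
    using W by (subst (asm) mult_le_cancel_right_pos) auto
  also have "\<dots> \<le> card (A <#> B) * \<alpha> ^ 4 * \<beta> ^ 3"
    using S(1) T(1) fin(1,2) nonneg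
    by (intro mult_right_mono of_nat_mono card_mono mono_set_mult finite_set_mult) auto
  finally show ?thesis
    unfolding \<alpha>_def \<beta>_def .
qed

theorem corollary2p4:
  fixes M :: "('a, 'b) monoid_scheme" (structure)
    and A B F G :: "'a set"
  assumes "comm_group M"
    and "A \<subseteq> carrier M" "B \<subseteq> carrier M" "F \<subseteq> carrier M" "G \<subseteq> carrier M"
    and "finite A" "finite B" "finite F" "finite G"
    and "A \<noteq> {}" "B \<noteq> {}" "F \<noteq> {}" "G \<noteq> {}"
  shows "real (card ((fold_product_set M 2 F <#> fold_product_set M 2 G) </> (fold_product_set M 2 F <#> G)))
           \<le> real (card (A <#> B)) * (real (card (A <#> F)) / real (card A)) ^ 4
               * (real (card (B <#> G)) / real (card B)) ^ 3
    \<and> (\<forall>t m :: real. t > 0 \<and> m > 0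
          \<and> real (card (A <#> F)) \<le> t \<and> real (card (B <#> G)) \<le> t \<and> real (card (A <#> B)) \<le> t
          \<and> real (card A) \<ge> m \<and> real (card B) \<ge> m
        \<longrightarrow> real (card ((fold_product_set M 2 F <#> fold_product_set M 2 G) </> (fold_product_set M 2 F <#> G)))
              \<le> t ^ 8 / (real (card A) ^ 4 * real (card B) ^ 3)
          \<and> t ^ 8 / (real (card A) ^ 4 * real (card B) ^ 3) \<le> t ^ 8 / m ^ 7)"
proof -
  interpret comm_group M by fact
  let ?Q = "(fold_product_set M 2 F <#> fold_product_set M 2 G) </> (fold_product_set M 2 F <#> G)"
  let ?R = "(F <#> F <#> (G <#> G)) </> (F <#> F <#> G)"
  let ?b = "real (card (A <#> B)) * (real (card (A <#> F)) / real (card A)) ^ 4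
               * (real (card (B <#> G)) / real (card B)) ^ 3"
  have "finite ?R"
    using assms by (intro finite_quotient_set finite_set_mult)
  moreover have "?Q \<subseteq> ?R"
    using assms by (intro quotient_set_mono mono_set_mult fold_product_set_two_subset subset_refl)
  ultimately have "card ?Q \<le> card ?R"
    by (rule card_mono)
  then have main: "real (card ?Q) \<le> ?b"
    using card_quotient_set_le[of A B F G] assms by linarith
  have "real (card ?Q) \<le> t ^ 8 / (real (card A) ^ 4 * real (card B) ^ 3)
      \<and> t ^ 8 / (real (card A) ^ 4 * real (card B) ^ 3) \<le> t ^ 8 / m ^ 7"
    if pos: "t > 0" "m > 0"
      and t: "real (card (A <#> F)) \<le> t" "real (card (B <#> G)) \<le> t" "real (card (A <#> B)) \<le> t"
      and m: "real (card A) \<ge> m" "real (card B) \<ge> m"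
    for t m :: real
  proof
    \<comment> \<open>Each of the three numerators is at most \<open>t\<close>, and 8 = 1 + 4 +
      3.\<close>
    have "?b \<le> t * (t / card A) ^ 4 * (t / card B) ^ 3"
      using pos t by (intro mult_mono power_mono divide_right_mono) auto
    also have "\<dots> = t ^ 8 / (real (card A) ^ 4 * real (card B) ^ 3)"
      by (simp add: power_divide eval_nat_numeral)
    finally show "real (card ?Q) \<le> t ^ 8 / (real (card A) ^ 4 * real (card B) ^ 3)"
      using main by linarith
    have "m ^ 7 = m ^ 4 * m ^ 3"
      by (simp flip: power_add)
    also have "\<dots> \<le> real (card A) ^ 4 * real (card B) ^ 3"
      using pos m by (intro mult_mono power_mono) auto
    finally show "t ^ 8 / (real (card A) ^ 4 * real (card B) ^ 3) \<le> t ^ 8 / m ^ 7"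
      using pos by (intro divide_left_mono mult_pos_pos zero_less_power less_le_trans[OF pos(2) m(1)]
        less_le_trans[OF pos(2) m(2)]) auto
  qed
  with main show ?thesis
    by blast
qed

end
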